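(* For every integer $n$ with $0\le n\le 3$ there is a smooth $S\in|\mathcal{O}_{\mathbb{F}}(1,2)|$ containing exactly $n$ twistor fibers. Moreover, there exists an irreducible surface of bidegree $(1,2)$ in $\mathbb{F}$ containing exactly $4$ twistor fibers.
   Context: Work over $\mathbb{C}$. For $p,\ell\in\mathbb{P}^2$ write $p\ell=p_0\ell_0+p_1\ell_1+p_2\ell_2$. The flag threefold is $\mathbb{F}=\{(p,\ell)\in\mathbb{P}^2\times\mathbb{P}^2 : p\ell=0\}$, and $\mathcal{O}_{\mathbb{F}}(a,b)$ is the restriction of $\mathcal{O}_{\mathbb{P}^2\times\mathbb{P}^2}(a,b)$; members of $|\mathcal{O}_{\mathbb{F}}(a,b)|$ are called surfaces of bidegree $(a,b)$. A twistor fiber is a curve $\{(p,\ell)\in\mathbb{F} : p\bar q=0,\ q\ell=0\}$ with $q\in\mathbb{P}^2$ (bar is complex conjugation of coordinates); equivalently, a fiber of the twistor map $\pi:\mathbb{F}\to\mathbb{P}^2$, $\pi(p,\ell)=\bar p\times\ell$ (formal cross product). *)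

theory Defs
  imports "HOL-Analysis.Analysis"
begin

section \<open>The complex projective plane\<close>

definition proj_rel :: "complex^3 \<Rightarrow> complex^3 \<Rightarrow> bool"
  where "proj_rel x y \<longleftrightarrow> x \<noteq> 0 \<and> y \<noteq> 0 \<and> (\<exists>c. c \<noteq> 0 \<and> y = c *s x)"

quotient_type p2 = "complex^3" / partial: proj_rel
proof (rule part_equivpI)
  have "proj_rel (axis 1 1) (axis 1 1)"
    unfolding proj_rel_def by (auto simp: axis_eq_0_iff intro!: exI[of _ 1])
  then show "\<exists>x. proj_rel x x" by blast
  show "symp proj_rel"
  proof (rule sympI)
    fix x y :: "complex^3"
    assume "proj_rel x y"
    then obtain c where c: "x \<noteq> 0" "y \<noteq> 0" "c \<noteq> 0" "y = c *s x"
      unfolding proj_rel_def by blast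
    then have "inverse c *s y = x"
      by (simp add: vector_smult_assoc)
    then show "proj_rel y x"
      unfolding proj_rel_def using c by (metis nonzero_imp_inverse_nonzero)
  qed
  show "transp proj_rel"
    unfolding proj_rel_def transp_def
    by (metis mult_eq_0_iff vector_smult_assoc)
qed

text \<open>For \<open>x \<noteq> 0\<close>, \<open>abs_p2 x\<close> is the point with homogeneous coordinates \<open>x\<close>.\<close>

text \<open>The bilinear form \<open>p\<^sub>0 \<ell>\<^sub>0 + p\<^sub>1 \<ell>\<^sub>1 + p\<^sub>2 \<ell>\<^sub>2\<close>; there is no conjugation.\<close>

definition pairing :: "complex^3 \<Rightarrow> complex^3 \<Rightarrow> complex"
  where "pairing x y = (\<Sum>i\<in>UNIV. x $ i * y $ i)"

lift_definition incident :: "p2 \<Rightarrow> p2 \<Rightarrow> bool"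
  is "\<lambda>x y. pairing x y = 0"
proof -
  fix x x' y y' :: "complex^3"
  assume "proj_rel x x'" "proj_rel y y'"
  then obtain c d where cd: "c \<noteq> 0" "x' = c *s x" "d \<noteq> 0" "y' = d *s y"
    unfolding proj_rel_def by blast
  have "pairing x' y' = c * d * pairing x y"
    unfolding pairing_def cd by (simp add: sum_distrib_left algebra_simps)
  then show "(pairing x y = 0) = (pairing x' y' = 0)"
    using cd by simp
qed

lift_definition conj_p2 :: "p2 \<Rightarrow> p2"
  is "\<lambda>x. \<chi> i. cnj (x $ i)"
proof -
  fix x y :: "complex^3"
  assume "proj_rel x y"
  then obtain c where c: "c \<noteq> 0" "x \<noteq> 0" "y \<noteq> 0" "y = c *s x"
    unfolding proj_rel_def by blast
  have "(\<chi> i. cnj (y $ i)) = cnj c *s (\<chi> i. cnj (x $ i))"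
    using c by (simp add: vec_eq_iff)
  moreover have "(\<chi> i. cnj (x $ i)) \<noteq> 0" "(\<chi> i. cnj (y $ i)) \<noteq> 0"
    using c by (simp_all add: vec_eq_iff)
  ultimately show "proj_rel (\<chi> i. cnj (x $ i)) (\<chi> i. cnj (y $ i))"
    unfolding proj_rel_def using c(1) by (metis complex_cnj_zero_iff)
qed


section \<open>The flag threefold and its twistor fibers\<close>

definition flag :: "(p2 \<times> p2) set"
  where "flag = {(p, l). incident p l}"

definition twistor_fiber :: "p2 \<Rightarrow> (p2 \<times> p2) set"
  where "twistor_fiber q = {(p, l) \<in> flag. incident p (conj_p2 q) \<and> incident q l}"

definition twistor_fibers_in :: "(p2 \<times> p2) set \<Rightarrow> (p2 \<times> p2) set set"
  where "twistor_fibers_in S = {C \<in> range twistor_fiber. C \<subseteq> S}"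


section \<open>Bihomogeneous forms and their zero loci\<close>

definition exponents :: "nat \<Rightarrow> (3 \<Rightarrow> nat) set"
  where "exponents d = {\<alpha>. (\<Sum>i\<in>UNIV. \<alpha> i) = d}"

lemma finite_exponents: "finite (exponents d)"
proof (rule finite_subset)
  show "exponents d \<subseteq> (UNIV \<rightarrow>\<^sub>E {..d})"
    unfolding exponents_def by (auto intro: member_le_sum)
  show "finite ((UNIV :: 3 set) \<rightarrow>\<^sub>E {..d})"
    by (intro finite_PiE) auto
qed

definition monomial_at :: "(3 \<Rightarrow> nat) \<Rightarrow> complex^3 \<Rightarrow> complex"
  where "monomial_at \<alpha> x = (\<Prod>i\<in>UNIV. (x $ i) ^ \<alpha> i)"

text \<open>Polynomials over the complex numbers are identified with polynomial functions. The
  elements of \<open>bihom a b\<close> are the global sections of \<open>\<O>(a,b)\<close> on the product of two planes.\<close>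

definition bihom :: "nat \<Rightarrow> nat \<Rightarrow> (complex^3 \<Rightarrow> complex^3 \<Rightarrow> complex) set"
  where "bihom a b = {f. \<exists>c. \<forall>x y. f x y =
    (\<Sum>\<alpha>\<in>exponents a. \<Sum>\<beta>\<in>exponents b. c \<alpha> \<beta> * monomial_at \<alpha> x * monomial_at \<beta> y)}"

definition zlocus :: "(complex^3 \<Rightarrow> complex^3 \<Rightarrow> complex) \<Rightarrow> (p2 \<times> p2) set"
  where "zlocus f = {(abs_p2 x, abs_p2 y) | x y. x \<noteq> 0 \<and> y \<noteq> 0 \<and> f x y = 0}"


section \<open>Surfaces of bidegree (a,b)\<close>

text \<open>A member of the linear system of \<open>\<O>(a,b)\<close> on the flag threefold is the divisor of a
  nonzero section, and every section is the restriction of a bihomogeneous form. The divisor is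
  represented by such a form \<open>f\<close>, which must not vanish identically on the flag threefold
  (equivalently, it is not a multiple of \<^const>\<open>pairing\<close>). The form retains the scheme
  structure, which matters for smoothness; the underlying set is \<open>surface f\<close>.\<close>

definition linear_system :: "nat \<Rightarrow> nat \<Rightarrow> (complex^3 \<Rightarrow> complex^3 \<Rightarrow> complex) set"
  where "linear_system a b = {f \<in> bihom a b. \<not> flag \<subseteq> zlocus f}"

definition surface :: "(complex^3 \<Rightarrow> complex^3 \<Rightarrow> complex) \<Rightarrow> (p2 \<times> p2) set"
  where "surface f = flag \<inter> zlocus f"

definition gradient ::
  "(complex^3 \<Rightarrow> complex^3 \<Rightarrow> complex) \<Rightarrow> complex^3 \<Rightarrow> complex^3 \<Rightarrow> complex^(3 + 3)"
  where "gradient g x y = (\<chi> k. case k of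
      Inl i \<Rightarrow> deriv (\<lambda>t. g (x + t *s axis i 1) y) 0
    | Inr j \<Rightarrow> deriv (\<lambda>t. g x (y + t *s axis j 1)) 0)"

definition jacobian ::
  "(complex^3 \<Rightarrow> complex^3 \<Rightarrow> complex) \<Rightarrow> complex^3 \<Rightarrow> complex^3 \<Rightarrow> complex^(3 + 3)^2"
  where "jacobian f x y = vector [gradient pairing x y, gradient f x y]"

text \<open>Jacobian criterion for the scheme cut out by the two bihomogeneous equations
  \<open>pairing = 0\<close> and \<open>f = 0\<close>: the Jacobian matrix has rank 2, the codimension, at every point of
  the scheme. It is taken in homogeneous coordinates, i.e. on the bicone minus \<open>x = 0\<close> and
  \<open>y = 0\<close>, a torus bundle over the surface; by Euler's formula the rank agrees with that of the
  Jacobian in the affine charts \<open>x\<^sub>i = y\<^sub>j = 1\<close>.\<close>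

definition smooth_surface :: "(complex^3 \<Rightarrow> complex^3 \<Rightarrow> complex) \<Rightarrow> bool"
  where "smooth_surface f \<longleftrightarrow> (\<forall>x y. x \<noteq> 0 \<longrightarrow> y \<noteq> 0 \<longrightarrow> pairing x y = 0 \<longrightarrow> f x y = 0 \<longrightarrow>
    rank (jacobian f x y) = 2)"

definition zariski_closed :: "(p2 \<times> p2) set \<Rightarrow> bool"
  where "zariski_closed Z \<longleftrightarrow> (\<exists>G. G \<subseteq> (\<Union>a b. bihom a b) \<and> Z = (\<Inter>g\<in>G. zlocus g))"

text \<open>Only meant for Zariski-closed \<open>S\<close> (such as \<open>surface f\<close>): then the relatively closed
  subsets of \<open>S\<close> are exactly the closed sets of the product contained in \<open>S\<close>.\<close>

definition zariski_irreducible :: "(p2 \<times> p2) set \<Rightarrow> bool"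
  where "zariski_irreducible S \<longleftrightarrow> S \<noteq> {} \<and>
    (\<forall>A B. zariski_closed A \<longrightarrow> zariski_closed B \<longrightarrow> S = A \<union> B \<longrightarrow> A = S \<or> B = S)"

end

theory Submission
  imports Defs "HOL-Computational_Algebra.Polynomial"
begin

text \<open>A form of bidegree \<open>(1,2)\<close> is \<open>f x y = x \<cdot> Q y\<close> with \<open>Q\<close> a triple of quadratic forms, so it is a
  quadratic self-map of the plane of lines. This turns both conditions into statements about \<open>Q\<close>.

  The twistor fiber of \<open>u\<close> is the graph of \<open>y \<mapsto> y \<times> cnj u\<close> over the line of all \<open>y\<close> with
  \<open>u \<cdot> y = 0\<close>. It lies in the surface exactly when the cubic \<open>det (y, cnj u, Q y)\<close> vanishes on that
  line (\<open>twistor_fiber_subset_surface_iff\<close>). For the sparse \<open>Q\<close> chosen below, the values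
  at the intersections with the coordinate lines already leave almost no candidates: a value tends to
  contain a factor \<open>\<bar>a\<bar>\<^sup>2 + \<bar>b\<bar>\<^sup>2\<close>, and such a factor vanishes only for \<open>a = b = 0\<close>.

  A point \<open>(x, y)\<close> is singular exactly when \<open>Q y = c y\<close> and \<open>DQ(y)\<^sup>T x = c x\<close> for one scalar
  \<open>c\<close> (\<open>smooth_surfaceI\<close>). Geometrically, the surface projects birationally to the plane of lines,
  a smooth surface is the blow-up of that plane in the seven fixed points of \<open>Q\<close>, and singularities
  arise when fixed points collide.

  The surface contains the fibers of all three coordinate points exactly if, modulo the equation of
  the flag threefold, \<open>f\<close> is a combination of the monomials \<open>x\<^sub>i y\<^sub>j y\<^sub>k\<close> with \<open>i, j, k\<close> distinct. Equal
  coefficients give the standard Cremona map \<open>Q\<close> and a smooth surface with three fibers.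
  One additional term breaks one of these fibers, and other sparse choices lead to one or no fiber.

  For four fibers, \<open>Q = (r\<^sub>1, r\<^sub>2, 0)\<close> is taken with coprime \<open>r\<^sub>1, r\<^sub>2\<close> depending on \<open>y\<^sub>1, y\<^sub>2\<close>
  only. All
  contained fibers then have their centers \<open>[1 : w : 0]\<close> or \<open>[0 : 1 : 0]\<close> on one line, and \<open>w\<close> is
  subject to an equation \<open>cnj w = R w\<close> with \<open>R\<close> rational of degree 2. The choice
  \<open>2 cnj w = w\<^sup>2 + 1\<close> has the three solutions \<open>1\<close> and \<open>-1 \<plusminus> 2 \<i>\<close>, and \<open>[0 : 1 : 0]\<close> is the fourth center.
  That surface is singular. Its irreducibility follows because it is the closure of the
  image of \<open>y \<mapsto> (y \<times> Q y, y)\<close> (\<open>irreducible_if_parametrized\<close>); the points over the base locus of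
  this map are reached along explicit polynomial arcs (\<open>vanishing_along_arc\<close>).\<close>


section \<open>Homogeneous coordinates\<close>

lemma vec3_eq_iff: "x = y \<longleftrightarrow> x$1 = y$1 \<and> x$2 = y$2 \<and> x$3 = y$3" for x y :: "complex^3"
  by (simp add: vec_eq_iff forall_3)

lemma vec3_neq_0_iff: "x \<noteq> 0 \<longleftrightarrow> x$1 \<noteq> 0 \<or> x$2 \<noteq> 0 \<or> x$3 \<noteq> 0" for x :: "complex^3"
  by (simp add: vec3_eq_iff)

lemma pairing_3: "pairing x y = x$1 * y$1 + x$2 * y$2 + x$3 * y$3"
  by (simp add: pairing_def sum_3)

lemma proj_rel_refl: "x \<noteq> 0 \<Longrightarrow> proj_rel x x"
  unfolding proj_rel_def by (auto intro!: exI[of _ 1])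

lemma abs_p2_eq_iff:
  assumes "x \<noteq> 0" "y \<noteq> 0"
  shows "abs_p2 x = abs_p2 y \<longleftrightarrow> (\<exists>c. c \<noteq> 0 \<and> y = c *s x)"
  using Quotient3_rel[OF Quotient3_p2, of x y] assms proj_rel_refl
  unfolding proj_rel_def by blast

lemma p2_cases:
  obtains x where "x \<noteq> 0" "q = abs_p2 x"
proof -
  obtain x where "proj_rel x x" "abs_p2 x = q"
    using Quotient3_abs_rep[OF Quotient3_p2] Quotient3_rep_reflp[OF Quotient3_p2] by metis
  then show ?thesis using that unfolding proj_rel_def by blast
qed

definition conj_vec :: "complex^3 \<Rightarrow> complex^3"
  where "conj_vec x = (\<chi> i. cnj (x $ i))"

lemma conj_vec_nth [simp]: "conj_vec x $ i = cnj (x $ i)"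
  by (simp add: conj_vec_def)

lemma conj_vec_neq_0: "x \<noteq> 0 \<Longrightarrow> conj_vec x \<noteq> 0"
  by (simp add: vec3_eq_iff)

lemma incident_abs:
  "x \<noteq> 0 \<Longrightarrow> y \<noteq> 0 \<Longrightarrow> incident (abs_p2 x) (abs_p2 y) \<longleftrightarrow> pairing x y = 0"
  by (simp add: incident.abs_eq proj_rel_refl)

lemma conj_p2_abs: "x \<noteq> 0 \<Longrightarrow> conj_p2 (abs_p2 x) = abs_p2 (conj_vec x)"
  by (simp add: conj_p2.abs_eq proj_rel_refl conj_vec_def)

lemma pairing_conj_self: "pairing x (conj_vec x) = of_real ((cmod (x$1))\<^sup>2 + (cmod (x$2))\<^sup>2 + (cmod (x$3))\<^sup>2)"
  unfolding pairing_3 of_real_add complex_norm_square by simp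

lemma pairing_conj_self_neq_0:
  assumes "x \<noteq> 0" shows "pairing x (conj_vec x) \<noteq> 0"
proof -
  have "(cmod (x$1))\<^sup>2 + (cmod (x$2))\<^sup>2 + (cmod (x$3))\<^sup>2 \<noteq> 0"
    using assms unfolding vec3_neq_0_iff
    by (auto simp: add_nonneg_eq_0_iff)
  then show ?thesis unfolding pairing_conj_self of_real_eq_0_iff .
qed

definition ccross :: "complex^3 \<Rightarrow> complex^3 \<Rightarrow> complex^3"
  where "ccross x y = vector [x$2 * y$3 - x$3 * y$2, x$3 * y$1 - x$1 * y$3, x$1 * y$2 - x$2 * y$1]"

lemma ccross_nth [simp]:
  "ccross x y $ 1 = x$2 * y$3 - x$3 * y$2"
  "ccross x y $ 2 = x$3 * y$1 - x$1 * y$3"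
  "ccross x y $ 3 = x$1 * y$2 - x$2 * y$1"
  by (simp_all add: ccross_def)

lemma pairing_ccross: "pairing (ccross x y) x = 0" "pairing (ccross x y) y = 0"
  by (simp_all add: pairing_3 algebra_simps)

lemma ccross_eq_0_imp_scale:
  assumes "x \<noteq> 0" "ccross x y = 0"
  shows "\<exists>c. y = c *s x"
proof -
  have e: "x$2 * y$3 = x$3 * y$2" "x$3 * y$1 = x$1 * y$3" "x$1 * y$2 = x$2 * y$1"
    using assms(2) by (simp_all add: vec3_eq_iff)
  from assms(1) consider "x$1 \<noteq> 0" | "x$2 \<noteq> 0" | "x$3 \<noteq> 0"
    unfolding vec3_neq_0_iff by blast
  then show ?thesis
  proof cases
    case 1 then show ?thesis using e
      by (intro exI[of _ "y$1 / x$1"]) (auto simp: vec3_eq_iff field_simps)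
  next
    case 2 then show ?thesis using e
      by (intro exI[of _ "y$2 / x$2"]) (auto simp: vec3_eq_iff field_simps)
  next
    case 3 then show ?thesis using e
      by (intro exI[of _ "y$3 / x$3"]) (auto simp: vec3_eq_iff field_simps)
  qed
qed

text \<open>By the expansion of the triple product \<open>(x \<times> y) \<times> p\<close>, a vector orthogonal to \<open>x\<close> and \<open>y\<close> is
  parallel to \<open>x \<times> y\<close>.\<close>

lemma orthogonal_imp_scale_ccross:
  assumes "ccross x y \<noteq> 0" "pairing p x = 0" "pairing p y = 0"
  shows "\<exists>c. p = c *s ccross x y"
proof (rule ccross_eq_0_imp_scale[OF assms(1)])
  have "ccross (ccross x y) p = pairing p x *s y - pairing p y *s x"
    by (simp add: vec3_eq_iff pairing_3 algebra_simps)
  then show "ccross (ccross x y) p = 0" using assms by simp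
qed

section \<open>Bihomogeneous forms\<close>

lemma monomial_at_scale: "\<alpha> \<in> exponents d \<Longrightarrow> monomial_at \<alpha> (c *s x) = c ^ d * monomial_at \<alpha> x"
  by (auto simp: monomial_at_def exponents_def power_mult_distrib prod.distrib power_sum)

lemma bihom_scale:
  assumes "f \<in> bihom a b"
  shows "f (c *s x) (d *s y) = c ^ a * d ^ b * f x y"
proof -
  obtain k where k: "\<And>x y. f x y =
    (\<Sum>\<alpha>\<in>exponents a. \<Sum>\<beta>\<in>exponents b. k \<alpha> \<beta> * monomial_at \<alpha> x * monomial_at \<beta> y)"
    using assms unfolding bihom_def by blast
  show ?thesis
    unfolding k sum_distrib_left
    by (intro sum.cong refl) (simp add: monomial_at_scale)
qed

lemma zlocus_abs_iff:
  assumes "f \<in> bihom a b" "x \<noteq> 0" "y \<noteq> 0"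
  shows "(abs_p2 x, abs_p2 y) \<in> zlocus f \<longleftrightarrow> f x y = 0"
proof
  assume "(abs_p2 x, abs_p2 y) \<in> zlocus f"
  then obtain x' y' where "x' \<noteq> 0" "y' \<noteq> 0" "f x' y' = 0" "abs_p2 x' = abs_p2 x" "abs_p2 y' = abs_p2 y"
    unfolding zlocus_def by auto
  moreover from this obtain c d where "x = c *s x'" "y = d *s y'"
    using assms abs_p2_eq_iff by metis
  ultimately show "f x y = 0"
    using bihom_scale[OF assms(1)] by simp
qed (use assms in \<open>auto simp: zlocus_def\<close>)

lemma surface_abs_iff:
  assumes "f \<in> bihom a b" "x \<noteq> 0" "y \<noteq> 0"
  shows "(abs_p2 x, abs_p2 y) \<in> surface f \<longleftrightarrow> pairing x y = 0 \<and> f x y = 0"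
  using zlocus_abs_iff[OF assms] assms by (simp add: surface_def flag_def incident_abs)

lemma linear_systemI:
  assumes "f \<in> bihom a b" "pairing x y = 0" "f x y \<noteq> 0" "x \<noteq> 0" "y \<noteq> 0"
  shows "f \<in> linear_system a b"
proof -
  have "(abs_p2 x, abs_p2 y) \<in> flag" "(abs_p2 x, abs_p2 y) \<notin> zlocus f"
    using assms zlocus_abs_iff[OF assms(1)] by (simp_all add: flag_def incident_abs)
  then show ?thesis using assms(1) unfolding linear_system_def by blast
qed

lemma bihom_add:
  assumes "f \<in> bihom a b" "g \<in> bihom a b"
  shows "(\<lambda>x y. f x y + g x y) \<in> bihom a b"
proof -
  obtain k l where
    "\<And>x y. f x y = (\<Sum>\<alpha>\<in>exponents a. \<Sum>\<beta>\<in>exponents b. k \<alpha> \<beta> * monomial_at \<alpha> x * monomial_at \<beta> y)"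
    "\<And>x y. g x y = (\<Sum>\<alpha>\<in>exponents a. \<Sum>\<beta>\<in>exponents b. l \<alpha> \<beta> * monomial_at \<alpha> x * monomial_at \<beta> y)"
    using assms unfolding bihom_def by blast
  then show ?thesis unfolding bihom_def
    by (intro CollectI exI[of _ "\<lambda>\<alpha> \<beta>. k \<alpha> \<beta> + l \<alpha> \<beta>"]) (simp add: sum.distrib distrib_right)
qed

lemma bihom_cmult:
  assumes "f \<in> bihom a b"
  shows "(\<lambda>x y. c * f x y) \<in> bihom a b"
proof -
  obtain k where
    "\<And>x y. f x y = (\<Sum>\<alpha>\<in>exponents a. \<Sum>\<beta>\<in>exponents b. k \<alpha> \<beta> * monomial_at \<alpha> x * monomial_at \<beta> y)"
    using assms unfolding bihom_def by blast
  then show ?thesis unfolding bihom_def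
    by (intro CollectI exI[of _ "\<lambda>\<alpha> \<beta>. c * k \<alpha> \<beta>"]) (simp add: sum_distrib_left mult.assoc)
qed

lemma bihom_monomial:
  assumes "\<alpha> \<in> exponents a" "\<beta> \<in> exponents b"
  shows "(\<lambda>x y. monomial_at \<alpha> x * monomial_at \<beta> y) \<in> bihom a b"
proof -
  have "monomial_at \<alpha> x * monomial_at \<beta> y = (\<Sum>\<alpha>'\<in>exponents a. \<Sum>\<beta>'\<in>exponents b.
      of_bool (\<alpha>' = \<alpha>) * of_bool (\<beta>' = \<beta>) * monomial_at \<alpha>' x * monomial_at \<beta>' y)" for x y
  proof -
    have "(\<Sum>\<alpha>'\<in>exponents a. \<Sum>\<beta>'\<in>exponents b.
      of_bool (\<alpha>' = \<alpha>) * of_bool (\<beta>' = \<beta>) * monomial_at \<alpha>' x * monomial_at \<beta>' y)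
      = (\<Sum>\<alpha>'\<in>exponents a. if \<alpha>' = \<alpha> then (\<Sum>\<beta>'\<in>exponents b.
        if \<beta>' = \<beta> then monomial_at \<alpha>' x * monomial_at \<beta>' y else 0) else 0)"
      by (intro sum.cong refl) (auto intro!: sum.cong)
    also have "\<dots> = monomial_at \<alpha> x * monomial_at \<beta> y"
      using assms by (simp add: finite_exponents)
    finally show ?thesis by simp
  qed
  then show ?thesis unfolding bihom_def
    by (intro CollectI exI[of _ "\<lambda>\<alpha>' \<beta>'. of_bool (\<alpha>' = \<alpha>) * of_bool (\<beta>' = \<beta>)"]) blast
qed

text \<open>Together with \<open>bihom_add\<close> and \<open>bihom_cmult\<close> this covers every form of bidegree \<open>(1,2)\<close>.\<close>

lemma bihom_1_2_monomial: "(\<lambda>x y. x $ i * (y $ j * y $ k)) \<in> bihom 1 2"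
proof -
  let ?\<alpha> = "\<lambda>n. of_bool (n = i)" and ?\<beta> = "\<lambda>n. of_bool (n = j) + of_bool (n = k)"
  have pw: "(z::complex) ^ (of_bool P) = (if P then z else 1)" for z P by simp
  have "?\<alpha> \<in> exponents 1" "?\<beta> \<in> exponents 2"
    by (simp_all add: exponents_def sum.distrib of_bool_def)
  from bihom_monomial[OF this] show ?thesis
    by (simp add: monomial_at_def power_add prod.distrib pw)
qed

section \<open>Twistor fibers contained in a surface\<close>

text \<open>The line of \<open>u\<close> does not contain the conjugate of \<open>u\<close>, since the Hermitian norm is definite.
  Hence a point \<open>y\<close> of that line and the conjugate of \<open>u\<close> span a line, and the cross product is
  the point dual to it.\<close>

lemma ccross_conj_neq_0:
  assumes "u \<noteq> 0" "y \<noteq> 0" "pairing u y = 0"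
  shows "ccross y (conj_vec u) \<noteq> 0"
proof
  assume "ccross y (conj_vec u) = 0"
  then obtain c where "conj_vec u = c *s y"
    using ccross_eq_0_imp_scale assms(2) by blast
  then have "pairing u (conj_vec u) = c * pairing u y"
    by (simp add: pairing_3 algebra_simps)
  then show False using assms pairing_conj_self_neq_0 by simp
qed

text \<open>A twistor fiber is a graph over the line of \<open>u\<close>: the first factor must be orthogonal both to
  \<open>y\<close> and to the conjugate of \<open>u\<close>, which determines it up to scaling.\<close>

lemma twistor_fiber_eq:
  assumes u: "u \<noteq> 0"
  shows "twistor_fiber (abs_p2 u) =
    {(abs_p2 (ccross y (conj_vec u)), abs_p2 y) | y. y \<noteq> 0 \<and> pairing u y = 0}" (is "?L = ?R")
proof (rule set_eqI, rule iffI)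
  fix z assume z: "z \<in> ?L"
  obtain x y where xy: "x \<noteq> 0" "y \<noteq> 0" "z = (abs_p2 x, abs_p2 y)"
    by (metis p2_cases surj_pair)
  from z have p: "pairing x y = 0" "pairing x (conj_vec u) = 0" "pairing u y = 0"
    using u xy conj_vec_neq_0[OF u] by (simp_all add: twistor_fiber_def flag_def incident_abs conj_p2_abs)
  have n: "ccross y (conj_vec u) \<noteq> 0" using ccross_conj_neq_0 u xy p by blast
  obtain c where c: "x = c *s ccross y (conj_vec u)"
    using orthogonal_imp_scale_ccross[OF n p(1) p(2)] by blast
  with xy have "c \<noteq> 0" by auto
  then have "abs_p2 x = abs_p2 (ccross y (conj_vec u))"
    using abs_p2_eq_iff[OF n xy(1)] c by auto
  then show "z \<in> ?R" using xy p by auto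
next
  fix z assume "z \<in> ?R"
  then obtain y where y: "y \<noteq> 0" "pairing u y = 0" "z = (abs_p2 (ccross y (conj_vec u)), abs_p2 y)"
    by auto
  then show "z \<in> ?L"
    using u conj_vec_neq_0[OF u] ccross_conj_neq_0[OF u y(1,2)]
    by (simp add: twistor_fiber_def flag_def incident_abs conj_p2_abs pairing_ccross)
qed

lemma twistor_fiber_subset_surface_iff:
  assumes f: "f \<in> bihom a b" and u: "u \<noteq> 0"
  shows "twistor_fiber (abs_p2 u) \<subseteq> surface f \<longleftrightarrow>
    (\<forall>y. y \<noteq> 0 \<longrightarrow> pairing u y = 0 \<longrightarrow> f (ccross y (conj_vec u)) y = 0)"
proof -
  have "(abs_p2 (ccross y (conj_vec u)), abs_p2 y) \<in> surface f \<longleftrightarrow> f (ccross y (conj_vec u)) y = 0"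
    if "y \<noteq> 0" "pairing u y = 0" for y
    using surface_abs_iff[OF f ccross_conj_neq_0[OF u that] that(1)] by (simp add: pairing_ccross)
  then show ?thesis unfolding twistor_fiber_eq[OF u] by auto
qed

text \<open>The second projection of the fiber recovers the line of \<open>q\<close>, and the line recovers \<open>q\<close>.\<close>

lemma twistor_fiber_inject:
  assumes "twistor_fiber q = twistor_fiber r"
  shows "q = r"
proof -
  obtain u where u: "u \<noteq> 0" "q = abs_p2 u" by (rule p2_cases)
  obtain v where v: "v \<noteq> 0" "r = abs_p2 v" by (rule p2_cases)
  have *: "pairing v y = 0" if y: "y \<noteq> 0" "pairing u y = 0" for y
  proof -
    have "(abs_p2 (ccross y (conj_vec u)), abs_p2 y) \<in> twistor_fiber r"
      using assms y unfolding u(2) twistor_fiber_eq[OF u(1)] by blast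
    then show ?thesis using v y by (simp add: twistor_fiber_def incident_abs)
  qed
  \<comment> \<open>These three points span the line of \<open>u\<close>; the three equations together say \<open>u \<times> v = 0\<close>.\<close>
  have "pairing v (vector [0, u$3, - u$2]) = 0" "pairing v (vector [- u$3, 0, u$1]) = 0"
    "pairing v (vector [u$2, - u$1, 0]) = 0"
    using *[of "vector [0, u$3, - u$2]"] *[of "vector [- u$3, 0, u$1]"] *[of "vector [u$2, - u$1, 0]"]
    by (fastforce simp: pairing_3 vec3_eq_iff)+
  then have "ccross u v = 0"
    by (simp add: pairing_3 vec3_eq_iff algebra_simps)
  then obtain c where c: "v = c *s u" using ccross_eq_0_imp_scale u by blast
  with v have "c \<noteq> 0" by auto
  with c show ?thesis using u v abs_p2_eq_iff by metis
qed

text \<open>Counting reduces to a finite list of vectors. In coordinates the line of \<open>q = [a : b : c]\<close>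
  consists of the \<open>[r : s : t]\<close> with \<open>a r + b s + c t = 0\<close>, and exclusion of further fibers
  works by substituting a few points of that line. Distinct centers give distinct fibers, so
  counting centers suffices.\<close>

lemma card_twistor_fibers:
  assumes f: "f \<in> bihom a b" "b > 0" and U: "finite U" "0 \<notin> U"
    and inj: "\<And>v w k. v \<in> U \<Longrightarrow> w \<in> U \<Longrightarrow> w = k *s v \<Longrightarrow> w = v"
    and fib: "\<And>v y. v \<in> U \<Longrightarrow> pairing v y = 0 \<Longrightarrow> f (ccross y (conj_vec v)) y = 0"
    and only: "\<And>a b c. a \<noteq> 0 \<or> b \<noteq> 0 \<or> c \<noteq> 0 \<Longrightarrow>
      (\<And>r s t. a * r + b * s + c * t = 0 \<Longrightarrow>
        f (vector [s * cnj c - t * cnj b, t * cnj a - r * cnj c, r * cnj b - s * cnj a]) (vector [r, s, t]) = 0) \<Longrightarrow>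
      \<exists>v\<in>U. \<exists>k. vector [a, b, c] = k *s v"
  shows "finite (twistor_fibers_in (surface f)) \<and> card (twistor_fibers_in (surface f)) = card U"
proof -
  have zero: "f x 0 = 0" for x
    using bihom_scale[OF f(1), of 1 x 0 0] f(2) by (simp add: power_0_left)
  have "twistor_fibers_in (surface f) = (\<lambda>v. twistor_fiber (abs_p2 v)) ` U"
  proof (intro set_eqI iffI)
    fix C assume "C \<in> twistor_fibers_in (surface f)"
    then obtain q where q: "C = twistor_fiber q" "C \<subseteq> surface f"
      unfolding twistor_fibers_in_def by auto
    obtain u where u: "u \<noteq> 0" "C = twistor_fiber (abs_p2 u)" "C \<subseteq> surface f"
      using q p2_cases[of q] by metis
    have vanish: "f (ccross y (conj_vec u)) y = 0" if "pairing u y = 0" for y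
      using u that zero twistor_fiber_subset_surface_iff[OF f(1) u(1)] by (cases "y = 0") auto
    have "\<exists>v\<in>U. \<exists>k. vector [u$1, u$2, u$3] = k *s v"
    proof (rule only)
      show "u$1 \<noteq> 0 \<or> u$2 \<noteq> 0 \<or> u$3 \<noteq> 0" using u(1) unfolding vec3_neq_0_iff .
      fix r s t assume "u$1 * r + u$2 * s + u$3 * t = 0"
      then show "f (vector [s * cnj (u$3) - t * cnj (u$2), t * cnj (u$1) - r * cnj (u$3),
          r * cnj (u$2) - s * cnj (u$1)]) (vector [r, s, t]) = 0"
        using vanish[of "vector [r, s, t]"] by (simp add: pairing_3 ccross_def)
    qed
    moreover have "u = vector [u$1, u$2, u$3]" by (simp add: vec3_eq_iff)
    ultimately obtain v k where v: "v \<in> U" "u = k *s v" by metis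
    then have "v \<noteq> 0" "k \<noteq> 0" using U u by auto
    then have "abs_p2 v = abs_p2 u" using v u abs_p2_eq_iff by metis
    then have "C = twistor_fiber (abs_p2 v)" using u(2) by simp
    then show "C \<in> (\<lambda>v. twistor_fiber (abs_p2 v)) ` U" using v(1) by blast
  next
    fix C assume "C \<in> (\<lambda>v. twistor_fiber (abs_p2 v)) ` U"
    then obtain v where v: "v \<in> U" "C = twistor_fiber (abs_p2 v)" by blast
    then have "v \<noteq> 0" using U by auto
    then show "C \<in> twistor_fibers_in (surface f)"
      using v fib twistor_fiber_subset_surface_iff[OF f(1)] by (simp add: twistor_fibers_in_def)
  qed
  moreover have "inj_on (\<lambda>v. twistor_fiber (abs_p2 v)) U"
  proof (rule inj_onI)
    fix v w assume vw: "v \<in> U" "w \<in> U" "twistor_fiber (abs_p2 v) = twistor_fiber (abs_p2 w)"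
    then have "v \<noteq> 0" "w \<noteq> 0" using U by auto
    then obtain c where "w = c *s v"
      using abs_p2_eq_iff twistor_fiber_inject[OF vw(3)] by blast
    then show "v = w" using inj vw by metis
  qed
  ultimately show ?thesis using U by (simp add: card_image)
qed

section \<open>The Jacobian criterion for forms linear in the point\<close>

lemma rank_two_rows:
  fixes a b :: "'a::field^'n"
  assumes "a \<noteq> 0" "\<And>c. b \<noteq> c *s a"
  shows "rank (vector [a, b] :: 'a^'n^2) = 2"
proof -
  have "rows (vector [a, b] :: 'a^'n^2) = range (($) (vector [a, b] :: 'a^'n^2))"
    unfolding rows_def row_def vec_lambda_eta setcompr_eq_image by simp
  then have r: "rows (vector [a, b] :: 'a^'n^2) = {b, a}"
    unfolding UNIV_2 by auto
  have "vec.independent {b, a}"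
    using assms by (auto simp: vec.independent_insert vec.span_singleton)
  moreover have "a \<noteq> b" using assms(2)[of 1] by simp
  ultimately show ?thesis
    unfolding row_rank_def_gen r by (simp add: vec.dim_eq_card_independent)
qed

lemma pairing_add_axis:
  "pairing (x + t *s axis i 1) y = pairing x y + t * y $ i"
  "pairing x (y + t *s axis i 1) = pairing x y + t * x $ i"
  using exhaust_3[of i] by (auto simp: pairing_3 axis_def algebra_simps)

lemma deriv_affine: "deriv (\<lambda>t. c + t * d) 0 = (d :: complex)"
  by (rule DERIV_imp_deriv) (auto intro!: derivative_eq_intros)

text \<open>For \<open>f x y = x \<cdot> Q y\<close> with \<open>Q\<close> quadratic, the two gradients are \<open>(y, x)\<close> and
  \<open>(Q y, DQ(y)\<^sup>T x)\<close>. They are dependent exactly when, for one scalar \<open>c\<close>, the point \<open>y\<close> is fixed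
  by \<open>Q\<close> with multiplier \<open>c\<close> and \<open>x\<close> is an eigenvector of \<open>DQ(y)\<^sup>T\<close> with eigenvalue \<open>c\<close>.
  The map \<open>Q' j\<close> stands for the partial derivative of \<open>Q\<close> in the direction \<open>j\<close>.\<close>

lemma smooth_surfaceI:
  assumes lin: "\<And>x y. f x y = pairing x (Q y)"
    and der: "\<And>x y j. ((\<lambda>t. pairing x (Q (y + t *s axis j 1))) has_field_derivative pairing x (Q' j y)) (at 0)"
    and regular: "\<And>x y c. \<lbrakk>x \<noteq> 0; y \<noteq> 0; pairing x y = 0; Q y = c *s y; \<And>j. pairing x (Q' j y) = c * x $ j\<rbrakk> \<Longrightarrow> False"
  shows "smooth_surface f"
  unfolding smooth_surface_def
proof (intro allI impI)
  fix x y assume xy: "x \<noteq> 0" "y \<noteq> 0" "pairing x y = 0" "f x y = 0"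
  have gp: "gradient pairing x y $ Inl i = y $ i" "gradient pairing x y $ Inr i = x $ i" for i
    by (simp_all add: gradient_def pairing_add_axis deriv_affine)
  have gf: "gradient f x y $ Inl i = Q y $ i" "gradient f x y $ Inr i = pairing x (Q' i y)" for i
    by (simp_all add: gradient_def lin pairing_add_axis deriv_affine DERIV_imp_deriv[OF der])
  show "rank (jacobian f x y) = 2"
    unfolding jacobian_def
  proof (rule rank_two_rows)
    obtain i where "y $ i \<noteq> 0" using xy(2) by (auto simp: vec_eq_iff)
    then show "gradient pairing x y \<noteq> 0" using gp(1)[of i] by auto
    show "gradient f x y \<noteq> c *s gradient pairing x y" for c
    proof
      assume e: "gradient f x y = c *s gradient pairing x y"
      have "Q y $ i = c * y $ i" "pairing x (Q' i y) = c * x $ i" for i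
        using arg_cong[OF e, of "\<lambda>v. v $ Inl i"] arg_cong[OF e, of "\<lambda>v. v $ Inr i"]
        by (simp_all add: gp gf)
      then show False using regular[of x y c] xy by (simp add: vec_eq_iff)
    qed
  qed
qed

section \<open>Irreducibility of parametrized surfaces\<close>

definition poly_fun :: "(complex \<Rightarrow> complex) \<Rightarrow> bool"
  where "poly_fun h \<longleftrightarrow> (\<exists>P. \<forall>t. h t = poly P t)"

lemma poly_fun_const [intro, simp]: "poly_fun (\<lambda>t. c)"
  unfolding poly_fun_def by (rule exI[of _ "[:c:]"]) simp

lemma poly_fun_id [intro, simp]: "poly_fun (\<lambda>t. t)"
  unfolding poly_fun_def by (rule exI[of _ "[:0, 1:]"]) simp

lemma poly_fun_add [intro, simp]: "poly_fun f \<Longrightarrow> poly_fun g \<Longrightarrow> poly_fun (\<lambda>t. f t + g t)"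
  unfolding poly_fun_def by (metis poly_add)

lemma poly_fun_diff [intro, simp]: "poly_fun f \<Longrightarrow> poly_fun g \<Longrightarrow> poly_fun (\<lambda>t. f t - g t)"
  unfolding poly_fun_def by (metis poly_diff)

lemma poly_fun_minus [intro, simp]: "poly_fun f \<Longrightarrow> poly_fun (\<lambda>t. - f t)"
  unfolding poly_fun_def by (metis poly_minus)

lemma poly_fun_mult [intro, simp]: "poly_fun f \<Longrightarrow> poly_fun g \<Longrightarrow> poly_fun (\<lambda>t. f t * g t)"
  unfolding poly_fun_def by (metis poly_mult)

lemma poly_fun_power [intro, simp]: "poly_fun f \<Longrightarrow> poly_fun (\<lambda>t. f t ^ n)"
  by (induction n) auto

lemma poly_fun_sum [intro]: "(\<And>i. i \<in> I \<Longrightarrow> poly_fun (f i)) \<Longrightarrow> poly_fun (\<lambda>t. \<Sum>i\<in>I. f i t)"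
  by (induction I rule: infinite_finite_induct) auto

lemma poly_fun_prod [intro]: "(\<And>i. i \<in> I \<Longrightarrow> poly_fun (f i)) \<Longrightarrow> poly_fun (\<lambda>t. \<Prod>i\<in>I. f i t)"
  by (induction I rule: infinite_finite_induct) auto

lemma poly_fun_bihom:
  assumes "g \<in> bihom a b" "\<And>i. poly_fun (\<lambda>t. X t $ i)" "\<And>i. poly_fun (\<lambda>t. Y t $ i)"
  shows "poly_fun (\<lambda>t. g (X t) (Y t))"
proof -
  obtain k where k: "\<And>x y. g x y =
    (\<Sum>\<alpha>\<in>exponents a. \<Sum>\<beta>\<in>exponents b. k \<alpha> \<beta> * monomial_at \<alpha> x * monomial_at \<beta> y)"
    using assms unfolding bihom_def by blast
  show ?thesis unfolding k monomial_at_def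
    by (intro poly_fun_sum poly_fun_mult poly_fun_prod poly_fun_power poly_fun_const assms)
qed

lemma poly_fun_finite_zeros:
  assumes "poly_fun h" "h s \<noteq> 0"
  shows "finite {t. h t = 0}"
proof -
  obtain P where P: "\<And>t. h t = poly P t" using assms(1) unfolding poly_fun_def by blast
  then have "P \<noteq> 0" using assms(2) by auto
  then show ?thesis unfolding P by (rule poly_roots_finite)
qed

lemma poly_fun_eq_0_at_0:
  assumes "poly_fun h" "\<And>t. t \<noteq> 0 \<Longrightarrow> h t = 0"
  shows "h 0 = 0"
proof (rule ccontr)
  assume "h 0 \<noteq> 0"
  then have "finite {t. h t = 0}" using poly_fun_finite_zeros assms(1) by blast
  moreover have "UNIV - {0} \<subseteq> {t. h t = 0}" using assms(2) by auto
  ultimately have "finite (UNIV - {0 :: complex})" using finite_subset by blast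
  then show False by (simp add: infinite_UNIV_char_0)
qed

text \<open>A product of nonzero polynomial functions is nonzero: on the line joining a point where \<open>F\<close> does
  not vanish to one where \<open>G\<close> does not, each has only finitely many zeros.\<close>

lemma common_nonzero:
  fixes F G :: "complex^3 \<Rightarrow> complex"
  assumes "\<And>p v. poly_fun (\<lambda>t. F (p + t *s v))" "\<And>p v. poly_fun (\<lambda>t. G (p + t *s v))"
    and "F p \<noteq> 0" "G q \<noteq> 0"
  shows "\<exists>r. F r * G r \<noteq> 0"
proof -
  let ?l = "\<lambda>t. p + t *s (q - p)"
  have "finite {t. F (?l t) = 0}" using poly_fun_finite_zeros[OF assms(1)[of p "q - p"], of 0] assms(3) by simp
  moreover have "finite {t. G (?l t) = 0}" using poly_fun_finite_zeros[OF assms(2)[of p "q - p"], of 1] assms(4) by simp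
  ultimately have "finite ({t. F (?l t) = 0} \<union> {t. G (?l t) = 0})" by blast
  then have "{t. F (?l t) = 0} \<union> {t. G (?l t) = 0} \<noteq> UNIV"
    using infinite_UNIV_char_0 by metis
  then show ?thesis by auto
qed

text \<open>The surface is the closure of the image of the rational map \<open>y \<mapsto> (\<phi> y, y)\<close> from the plane. If two
  proper closed subsets covered it, each would lie in the zero locus of a form that does not vanish
  on the image, and the product of the two pulled back forms would vanish wherever \<open>\<phi>\<close> does not.
  The hypothesis \<open>dense\<close> says that forms vanishing on the image vanish on \<open>S\<close>.\<close>

lemma irreducible_if_parametrized:
  assumes poly: "\<And>p v i. poly_fun (\<lambda>t. \<phi> (p + t *s v) $ i)"
    and nonconst: "\<phi> 0 = 0" "\<phi> y0 \<noteq> 0"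
    and into: "\<And>y. \<phi> y \<noteq> 0 \<Longrightarrow> (abs_p2 (\<phi> y), abs_p2 y) \<in> S"
    and dense: "\<And>g a b z. g \<in> bihom a b \<Longrightarrow> (\<And>y. g (\<phi> y) y = 0) \<Longrightarrow> z \<in> S \<Longrightarrow> z \<in> zlocus g"
  shows "zariski_irreducible S"
  unfolding zariski_irreducible_def
proof (intro conjI allI impI)
  show "S \<noteq> {}" using into[OF nonconst(2)] by blast
  fix A B assume cl: "zariski_closed A" "zariski_closed B" and S: "S = A \<union> B"
  have sep: "\<exists>g a b y. g \<in> bihom a b \<and> C \<subseteq> zlocus g \<and> g (\<phi> y) y \<noteq> 0" if C: "zariski_closed C" "C \<subset> S" for C
  proof -
    obtain H where H: "H \<subseteq> (\<Union>a b. bihom a b)" "C = (\<Inter>g\<in>H. zlocus g)"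
      using C(1) unfolding zariski_closed_def by (elim exE conjE) (rule that)
    obtain z where z: "z \<in> S" "z \<notin> C" using C(2) by blast
    obtain g where g: "g \<in> H" "z \<notin> zlocus g" using H(2) z(2) by blast
    obtain a b where ab: "g \<in> bihom a b" using H(1) g(1) by blast
    obtain y where "g (\<phi> y) y \<noteq> 0" using dense[OF ab _ z(1)] g(2) by metis
    moreover have "C \<subseteq> zlocus g" using H(2) g(1) by blast
    ultimately show ?thesis using ab by metis
  qed
  show "A = S \<or> B = S"
  proof (rule ccontr)
    assume "\<not> (A = S \<or> B = S)"
    then have "A \<subset> S" "B \<subset> S" using S by auto
    then obtain g a b y h c d w where g: "g \<in> bihom a b" "A \<subseteq> zlocus g" "g (\<phi> y) y \<noteq> 0"
      and h: "h \<in> bihom c d" "B \<subseteq> zlocus h" "h (\<phi> w) w \<noteq> 0"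
      using sep cl by metis
    obtain k where k: "\<phi> y0 $ k \<noteq> 0" using nonconst(2) by (auto simp: vec_eq_iff)
    have pg: "poly_fun (\<lambda>t. g (\<phi> (p + t *s v)) (p + t *s v))"
      and ph: "poly_fun (\<lambda>t. h (\<phi> (p + t *s v)) (p + t *s v))" for p v
      by (rule poly_fun_bihom[OF g(1)] poly_fun_bihom[OF h(1)]; simp add: poly)+
    obtain r where r: "g (\<phi> r) r * h (\<phi> r) r \<noteq> 0"
      using common_nonzero[OF pg ph g(3) h(3)] by blast
    \<comment> \<open>A third factor keeps the point away from the base locus of \<open>\<phi>\<close>, where a form of
      degree \<open>0\<close> in the first variable need not vanish.\<close>
    obtain s where "(g (\<phi> s) s * h (\<phi> s) s) * \<phi> s $ k \<noteq> 0"
      using common_nonzero[OF poly_fun_mult[OF pg ph] poly r k] by blast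
    then have s: "g (\<phi> s) s \<noteq> 0" "h (\<phi> s) s \<noteq> 0" "\<phi> s \<noteq> 0" by auto
    then have "s \<noteq> 0" using nonconst(1) by auto
    have "(abs_p2 (\<phi> s), abs_p2 s) \<in> zlocus g \<union> zlocus h" using into[OF s(3)] S g(2) h(2) by blast
    then show False
      using s zlocus_abs_iff[OF g(1) s(3) \<open>s \<noteq> 0\<close>] zlocus_abs_iff[OF h(1) s(3) \<open>s \<noteq> 0\<close>] by simp
  qed
qed

text \<open>Points over the base locus of \<open>\<phi>\<close> are limits of image points. The arc \<open>(X t, Y t)\<close> is the
  image of \<open>Y t\<close> after a power of \<open>t\<close> has been cleared from \<open>\<phi> (Y t)\<close>; a form vanishing on the image
  vanishes along it for \<open>t \<noteq> 0\<close>, hence also at \<open>t = 0\<close>.\<close>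

lemma vanishing_along_arc:
  assumes g: "g \<in> bihom a b" "\<And>y. g (\<phi> y) y = 0"
    and poly: "\<And>i. poly_fun (\<lambda>t. X t $ i)" "\<And>i. poly_fun (\<lambda>t. Y t $ i)"
    and arc: "\<And>t. \<phi> (Y t) = t ^ n *s X t"
  shows "g (X 0) (Y 0) = 0"
proof (rule poly_fun_eq_0_at_0[where h = "\<lambda>t. g (X t) (Y t)"])
  show "poly_fun (\<lambda>t. g (X t) (Y t))" using poly_fun_bihom g(1) poly by blast
  fix t :: complex assume "t \<noteq> 0"
  have "0 = g (t ^ n *s X t) (1 *s Y t)" using g(2)[of "Y t"] arc by simp
  also have "\<dots> = (t ^ n) ^ a * g (X t) (Y t)" unfolding bihom_scale[OF g(1)] by simp
  finally show "g (X t) (Y t) = 0" using \<open>t \<noteq> 0\<close> by simp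
qed

section \<open>Restriction of a form to a line\<close>

lemmas vec3_simps = pairing_3 vec3_eq_iff axis_def

lemma conj_norm_eq_0_iff: "a * cnj a + b * cnj b = 0 \<longleftrightarrow> a = 0 \<and> b = 0"
proof -
  have "a * cnj a + b * cnj b = of_real ((cmod a)\<^sup>2 + (cmod b)\<^sup>2)"
    unfolding of_real_add complex_norm_square ..
  then show ?thesis by (simp only: of_real_eq_0_iff) (auto simp: add_nonneg_eq_0_iff)
qed

text \<open>The intersections of the line \<open>[a : b : c]\<close> with the coordinate lines. At these points the
  restricted cubic factors, often with a Hermitian norm as one factor.\<close>

lemma points_on_line:
  fixes a b c :: complex
  shows "a * 0 + b * c + c * (- b) = 0" "a * c + b * 0 + c * (- a) = 0" "a * b + b * (- a) + c * 0 = 0"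
  by simp_all

section \<open>A smooth surface without twistor fibers\<close>

definition fermat_form :: "complex^3 \<Rightarrow> complex^3 \<Rightarrow> complex"
  where "fermat_form x y = x$1 * (y$1 * y$1) + x$2 * (y$2 * y$2) + x$3 * (y$3 * y$3)"

lemma bihom_fermat_form: "fermat_form \<in> bihom 1 2"
  unfolding fermat_form_def by (intro bihom_add bihom_cmult bihom_1_2_monomial)

lemma linear_system_fermat_form: "fermat_form \<in> linear_system 1 2"
  by (rule linear_systemI[OF bihom_fermat_form, of "vector [2, - 1, 0]" "vector [1, 2, 0]"])
    (simp_all add: fermat_form_def vec3_simps)

text \<open>The fixed points are the seven points with coordinates in \<open>{0, 1}\<close>; there the multiplier is \<open>1\<close>,
  while every eigenvalue of \<open>DQ\<close> is \<open>0\<close> or \<open>2\<close>.\<close>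

lemma smooth_fermat_form: "smooth_surface fermat_form"
proof -
  let ?Q = "\<lambda>y. vector [y$1 * y$1, y$2 * y$2, y$3 * y$3] :: complex^3"
  let ?Q' = "\<lambda>j y. vector [2 * y$1 * axis j 1 $ 1, 2 * y$2 * axis j 1 $ 2, 2 * y$3 * axis j 1 $ 3] :: complex^3"
  show ?thesis
  proof (rule smooth_surfaceI[where Q = ?Q and Q' = ?Q'])
    fix x y :: "complex^3" and c
    assume xy: "x \<noteq> 0" "y \<noteq> 0" "pairing x y = 0"
      and e: "?Q y = c *s y" and d: "\<And>j. pairing x (?Q' j y) = c * x $ j"
    have "y$1 = 0 \<or> y$1 = c" "y$2 = 0 \<or> y$2 = c" "y$3 = 0 \<or> y$3 = c" using e
      by (auto simp: vec3_simps)
    moreover have "2 * y$1 * x$1 = c * x$1" "2 * y$2 * x$2 = c * x$2" "2 * y$3 * x$3 = c * x$3"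
      using d[of 1] d[of 2] d[of 3] by (simp_all add: vec3_simps)
    moreover have "c \<noteq> 0" using calculation(1-3) xy(2) by (auto simp: vec3_simps)
    ultimately show False using xy(1) by (auto simp: vec3_simps)
  qed (auto simp: fermat_form_def vec3_simps algebra_simps intro!: derivative_eq_intros)
qed

text \<open>The values at the coordinate lines force a coordinate of the center to vanish; on the
  line of such a center, one coefficient of the cubic is a Hermitian norm, so the cubic is not zero.\<close>

lemma twistor_fibers_fermat_form:
  "finite (twistor_fibers_in (surface fermat_form)) \<and> card (twistor_fibers_in (surface fermat_form)) = 0"
proof -
  let ?U = "{} :: (complex^3) set"
  have "finite (twistor_fibers_in (surface fermat_form)) \<and>
    card (twistor_fibers_in (surface fermat_form)) = card ?U"
  proof (rule card_twistor_fibers[OF bihom_fermat_form])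
    fix a b c :: complex
    assume abc: "a \<noteq> 0 \<or> b \<noteq> 0 \<or> c \<noteq> 0"
      and "\<And>r s t. a * r + b * s + c * t = 0 \<Longrightarrow> fermat_form
        (vector [s * cnj c - t * cnj b, t * cnj a - r * cnj c, r * cnj b - s * cnj a]) (vector [r, s, t]) = 0"
    then have t: "(s * cnj c - t * cnj b) * (r * r) + (t * cnj a - r * cnj c) * (s * s)
      + (r * cnj b - s * cnj a) * (t * t) = 0"
      if "a * r + b * s + c * t = 0" for r s t
      using that by (simp add: fermat_form_def algebra_simps)
    have "b * c * cnj a * (b + c) = 0" using t[OF points_on_line(1)] by algebra
    moreover have "a * c * cnj b * (a + c) = 0" using t[OF points_on_line(2)] by algebra
    moreover have "a * b * cnj c * (a + b) = 0" using t[OF points_on_line(3)] by algebra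
    ultimately have "a = 0 \<or> b = 0 \<or> c = 0"
      by (auto simp: add_eq_0_iff)
    \<comment> \<open>If, say, \<open>a = 0\<close>, the restriction has the term \<open>(\<bar>b\<bar>\<^sup>2 + \<bar>c\<bar>\<^sup>2) r\<^sup>2\<close>, the part even in \<open>r\<close>
      at the points \<open>[r : c : -b]\<close>; the values at \<open>r = 1\<close> and \<open>r = -1\<close> isolate it.\<close>
    moreover have False if "a = 0"
    proof -
      have "a * 1 + b * c + c * (- b) = 0" "a * (- 1) + b * c + c * (- b) = 0" using that by simp_all
      from t[OF this(1)] t[OF this(2)] have "2 * (b * cnj b + c * cnj c) = 2 * 0"
        using that complex_cnj_zero by algebra
      then show ?thesis using that abc conj_norm_eq_0_iff[of b c] unfolding mult_cancel_left by simp
    qed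
    moreover have False if "b = 0"
    proof -
      have "a * c + b * 1 + c * (- a) = 0" "a * c + b * (- 1) + c * (- a) = 0" using that by simp_all
      from t[OF this(1)] t[OF this(2)] have "2 * (a * cnj a + c * cnj c) = 2 * 0"
        using that complex_cnj_zero by algebra
      then show ?thesis using that abc conj_norm_eq_0_iff[of a c] unfolding mult_cancel_left by simp
    qed
    moreover have False if "c = 0"
    proof -
      have "a * b + b * (- a) + c * 1 = 0" "a * b + b * (- a) + c * (- 1) = 0" using that by simp_all
      from t[OF this(1)] t[OF this(2)] have "2 * (a * cnj a + b * cnj b) = 2 * 0"
        using that complex_cnj_zero by algebra
      then show ?thesis using that abc conj_norm_eq_0_iff[of a b] unfolding mult_cancel_left by simp
    qed
    ultimately show "\<exists>v\<in>?U. \<exists>k. vector [a, b, c] = k *s v" by blast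
  qed (auto simp: vec3_simps)
  moreover have "card ?U = 0" by (simp add: vec3_simps)
  ultimately show ?thesis by simp
qed

section \<open>A smooth surface with one twistor fiber\<close>

definition one_fiber_form :: "complex^3 \<Rightarrow> complex^3 \<Rightarrow> complex"
  where "one_fiber_form x y = x$1 * (y$2 * y$2) + x$1 * (y$3 * y$3) + 2 * (x$1 * (y$1 * y$1)) + x$3 * (y$1 * y$3)"

lemma bihom_one_fiber_form: "one_fiber_form \<in> bihom 1 2"
  unfolding one_fiber_form_def by (intro bihom_add bihom_cmult bihom_1_2_monomial)

lemma linear_system_one_fiber_form: "one_fiber_form \<in> linear_system 1 2"
  by (rule linear_systemI[OF bihom_one_fiber_form, of "vector [1, 0, 0]" "vector [0, 1, 0]"])
    (simp_all add: one_fiber_form_def vec3_simps)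

text \<open>The fixed points are \<open>[0 : 1 : \<plusminus>\<i>]\<close> and \<open>[1 : \<plusminus>\<i>\<surd>2 : 0]\<close> with multiplier \<open>0\<close>, and \<open>[1 : 0 : 0]\<close>
  and \<open>[1 : 0 : \<plusminus>\<i>]\<close> with nonzero multiplier. As they are seven distinct points, each is simple.\<close>

lemma smooth_one_fiber_form: "smooth_surface one_fiber_form"
proof -
  let ?Q = "\<lambda>y. vector [y$2 * y$2 + y$3 * y$3 + 2 * y$1 * y$1, 0, y$1 * y$3] :: complex^3"
  let ?Q' = "\<lambda>j y. vector [2 * y$2 * axis j 1 $ 2 + 2 * y$3 * axis j 1 $ 3 + 4 * y$1 * axis j 1 $ 1, 0,
      y$1 * axis j 1 $ 3 + axis j 1 $ 1 * y$3] :: complex^3"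
  show ?thesis
  proof (rule smooth_surfaceI[where Q = ?Q and Q' = ?Q'])
    fix x y :: "complex^3" and c
    assume xy: "x \<noteq> 0" "y \<noteq> 0" "pairing x y = 0"
      and e: "?Q y = c *s y" and d: "\<And>j. pairing x (?Q' j y) = c * x $ j"
    have e: "y$2 * y$2 + y$3 * y$3 + 2 * y$1 * y$1 = c * y$1" "c * y$2 = 0" "y$1 * y$3 = c * y$3"
      using e by (auto simp: vec3_simps algebra_simps)
    have d: "4 * x$1 * y$1 + x$3 * y$3 = c * x$1" "2 * x$1 * y$2 = c * x$2" "2 * x$1 * y$3 + x$3 * y$1 = c * x$3"
      using d[of 1] d[of 2] d[of 3] by (simp_all add: vec3_simps algebra_simps)
    have p: "x$1 * y$1 + x$2 * y$2 + x$3 * y$3 = 0" using xy by (simp add: vec3_simps)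
    show False
    proof (cases "c = 0")
      case True
      show False
      proof (cases "y$1 = 0")
        case y: True
        then have "y$2 \<noteq> 0" "y$3 \<noteq> 0" using e True xy(2) by (auto simp: vec3_simps)
        then show False using y True d p xy by (auto simp: vec3_simps)
      next
        case y: False
        then have "y$3 = 0" "y$2 \<noteq> 0" using e True xy(2) by (auto simp: vec3_simps)
        then show False using y True d p xy by (auto simp: vec3_simps)
      qed
    next
      case c: False
      then have y2: "y$2 = 0" and x2: "x$2 = 0" using e d by auto
      show False
      proof (cases "y$3 = 0")
        case True
        then have "y$1 \<noteq> 0" using y2 xy by (auto simp: vec3_simps)
        then have "c = 2 * y$1" using e(1) True y2 by auto
        then show False using d x2 xy c True by (auto simp: vec3_simps)
      next
        case False
        then have "y$1 = c" using e by auto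
        then show False using d x2 xy c False by (auto simp: vec3_simps)
      qed
    qed
  qed (auto simp: one_fiber_form_def vec3_simps algebra_simps intro!: derivative_eq_intros)
qed

text \<open>On the line \<open>y\<^sub>1 = 0\<close> of the center \<open>[1 : 0 : 0]\<close>, the map \<open>Q\<close> takes values proportional to that
  center itself, so the determinant vanishes. The values at the coordinate lines leave only
  \<open>[0 : 1 : \<plusminus>\<i>]\<close> as further candidates, which one more point of the line excludes.\<close>

lemma twistor_fibers_one_fiber_form:
  "finite (twistor_fibers_in (surface one_fiber_form)) \<and> card (twistor_fibers_in (surface one_fiber_form)) = 1"
proof -
  let ?U = "{axis 1 1} :: (complex^3) set"
  have "finite (twistor_fibers_in (surface one_fiber_form)) \<and>
    card (twistor_fibers_in (surface one_fiber_form)) = card ?U"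
  proof (rule card_twistor_fibers[OF bihom_one_fiber_form])
    fix a b c :: complex
    assume abc: "a \<noteq> 0 \<or> b \<noteq> 0 \<or> c \<noteq> 0"
      and "\<And>r s t. a * r + b * s + c * t = 0 \<Longrightarrow> one_fiber_form
        (vector [s * cnj c - t * cnj b, t * cnj a - r * cnj c, r * cnj b - s * cnj a]) (vector [r, s, t]) = 0"
    then have t: "(s * cnj c - t * cnj b) * (s * s + t * t + 2 * (r * r)) + (r * cnj b - s * cnj a) * (r * t) = 0"
      if "a * r + b * s + c * t = 0" for r s t
      using that by (simp add: one_fiber_form_def algebra_simps)
    have "(b * cnj b + c * cnj c) * (b * b + c * c) = 0" using t[OF points_on_line(1)] by algebra
    moreover have 2: "a * cnj b * (a * a + c * c) = 0" using t[OF points_on_line(2)] by algebra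
    moreover have 3: "a * cnj c * (a * a + 2 * b * b) = 0" using t[OF points_on_line(3)] by algebra
    moreover have False if "b * cnj b + c * cnj c \<noteq> 0"
    proof -
      have bc: "b * b + c * c = 0" using that calculation by simp
      then have nz: "b \<noteq> 0" "c \<noteq> 0" using that by auto
      have "(b - \<i> * c) * (b + \<i> * c) = b * b + c * c" by (simp add: algebra_simps)
      then have "b = \<i> * c \<or> b = - \<i> * c" using bc by (auto simp: add_eq_0_iff2)
      then have n: "b * cnj b = c * cnj c" by (auto simp: algebra_simps)
      have "a = 0"
      proof (rule ccontr)
        assume "a \<noteq> 0"
        then have "a * a + c * c = 0" "a * a + 2 * b * b = 0" using 2 3 nz by auto
        then have "3 * (c * c) = 0" using bc by algebra
        then show False using nz by simp
      qed
      then have "(c * cnj c + b * cnj b) * (c * c + b * b + 2) - b * cnj b = 0"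
        using t[of 1 c "-b"] by (simp add: algebra_simps)
      then have "3 * (c * cnj c) = 0" using bc n by algebra
      then show False using nz by simp
    qed
    ultimately have "b * cnj b + c * cnj c = 0" by blast
    then have "b = 0" "c = 0" using conj_norm_eq_0_iff by auto
    then have "(vector [a, b, c] :: complex^3) = a *s axis 1 1" by (auto simp: vec3_simps)
    then show "\<exists>v\<in>?U. \<exists>k. vector [a, b, c] = k *s v" by blast
  next
    fix v y :: "complex^3" assume "v \<in> ?U" "pairing v y = 0"
    then show "one_fiber_form (ccross y (conj_vec v)) y = 0" by (auto simp: one_fiber_form_def vec3_simps)
  qed (auto simp: vec3_simps)
  moreover have "card ?U = 1" by (simp add: vec3_simps)
  ultimately show ?thesis by simp
qed

section \<open>A smooth surface with two twistor fibers\<close>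

text \<open>Without the term \<open>2 x\<^sub>1 y\<^sub>2\<^sup>2\<close> this is the Cremona case with three fibers. The term breaks the fiber
  of \<open>[0 : 0 : 1]\<close> and leaves the other two. For a coefficient \<open>k\<close> in place of \<open>2\<close>, the fiber of
  \<open>[0 : k : 1]\<close> would be contained exactly if \<open>k + cnj k = 0\<close>, and for \<open>k = \<plusminus>1\<close> fixed points collide.\<close>

definition two_fiber_form :: "complex^3 \<Rightarrow> complex^3 \<Rightarrow> complex"
  where "two_fiber_form x y = x$1 * (y$2 * y$3) + 2 * (x$1 * (y$2 * y$2)) + x$2 * (y$1 * y$3) + x$3 * (y$1 * y$2)"

lemma bihom_two_fiber_form: "two_fiber_form \<in> bihom 1 2"
  unfolding two_fiber_form_def by (intro bihom_add bihom_cmult bihom_1_2_monomial)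

lemma linear_system_two_fiber_form: "two_fiber_form \<in> linear_system 1 2"
  by (rule linear_systemI[OF bihom_two_fiber_form, of "vector [1, 0, 0]" "vector [0, 1, 0]"])
    (simp_all add: two_fiber_form_def vec3_simps)

text \<open>The fixed points are \<open>[0 : 1 : -2]\<close> and two coordinate points, with multiplier \<open>0\<close>, and two pairs
  with \<open>y\<^sub>1 = c\<close>, \<open>y\<^sub>3 = y\<^sub>2\<close> and \<open>y\<^sub>1 = -c\<close>, \<open>y\<^sub>3 = -y\<^sub>2\<close>. In each case the equations for \<open>x\<close> are linear with
  only the zero solution.\<close>

lemma smooth_two_fiber_form: "smooth_surface two_fiber_form"
proof -
  let ?Q = "\<lambda>y. vector [y$2 * y$3 + 2 * y$2 * y$2, y$1 * y$3, y$1 * y$2] :: complex^3"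
  let ?Q' = "\<lambda>j y. vector [y$2 * axis j 1 $ 3 + axis j 1 $ 2 * y$3 + 4 * y$2 * axis j 1 $ 2,
      y$1 * axis j 1 $ 3 + axis j 1 $ 1 * y$3, y$1 * axis j 1 $ 2 + axis j 1 $ 1 * y$2] :: complex^3"
  show ?thesis
  proof (rule smooth_surfaceI[where Q = ?Q and Q' = ?Q'])
    fix x y :: "complex^3" and c
    assume xy: "x \<noteq> 0" "y \<noteq> 0" "pairing x y = 0"
      and e: "?Q y = c *s y" and d: "\<And>j. pairing x (?Q' j y) = c * x $ j"
    have e: "y$2 * (y$3 + 2 * y$2) = c * y$1" "y$1 * y$3 = c * y$2" "y$1 * y$2 = c * y$3"
      using e by (auto simp: vec3_simps algebra_simps)
    have d: "x$2 * y$3 + x$3 * y$2 = c * x$1" "x$1 * (y$3 + 4 * y$2) + x$3 * y$1 = c * x$2" "x$1 * y$2 + x$2 * y$1 = c * x$3"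
      using d[of 1] d[of 2] d[of 3] by (simp_all add: vec3_simps algebra_simps)
    have p: "x$1 * y$1 + x$2 * y$2 + x$3 * y$3 = 0" using xy by (simp add: vec3_simps)
    show False
    proof (cases "c = 0")
      case True
      show False
      proof (cases "y$1 = 0 \<and> y$2 \<noteq> 0")
        case y: True
        then have "y$3 = - 2 * y$2" using e True by (auto simp: add_eq_0_iff)
        moreover have "x$1 = 0" using d y True by auto
        moreover have "3 * y$2 * x$2 = 0" "3 * y$2 * x$3 = 0" using calculation d(1) p True by algebra+
        ultimately show False using y xy by (auto simp: vec3_simps)
      next
        case False
        then show False using True e d p xy by (auto simp: vec3_simps)
      qed
    next
      case c: False
      have y: "y$1 \<noteq> 0" "y$2 \<noteq> 0" "y$3 \<noteq> 0" using e c xy(2) by (auto simp: vec3_simps)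
      have "y$2 * (y$1 * y$1) = y$2 * (c * c)" using e by algebra
      then have "y$1 = c \<or> y$1 = - c" using y by (simp add: square_eq_iff)
      then have "x$1 = 0 \<and> x$2 = 0 \<and> x$3 = 0"
      proof
        assume "y$1 = c"
        moreover have "y$3 = y$2" using calculation e(3) c by auto
        moreover have "6 * y$2 * x$1 = (x$1 * (y$3 + 4 * y$2) + x$3 * y$1 - c * x$2) + (x$1 * y$2 + x$2 * y$1 - c * x$3)"
          using calculation by (simp add: algebra_simps)
        moreover have "(x$1 * (y$3 + 4 * y$2) + x$3 * y$1 - c * x$2) + (x$1 * y$2 + x$2 * y$1 - c * x$3) = 0" using d(2,3) by simp
        ultimately have "y$1 = c" "y$3 = y$2" "x$1 = 0" using y by simp_all
        moreover from this have "x$2 = x$3" "x$2 = - x$3" using d c y by auto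
        ultimately show ?thesis using y by auto
      next
        assume "y$1 = - c"
        moreover have "y$3 = - y$2"
          using calculation e(3) c by (metis mult_minus_left mult_minus_right mult_left_cancel)
        moreover have "2 * y$2 * x$1 = (x$1 * (y$3 + 4 * y$2) + x$3 * y$1 - c * x$2) - (x$1 * y$2 + x$2 * y$1 - c * x$3)"
          using calculation by (simp add: algebra_simps)
        moreover have "(x$1 * (y$3 + 4 * y$2) + x$3 * y$1 - c * x$2) - (x$1 * y$2 + x$2 * y$1 - c * x$3) = 0" using d(2,3) by simp
        ultimately have "y$1 = - c" "y$3 = - y$2" "x$1 = 0" using y by simp_all
        moreover from this have "x$2 = x$3" "x$2 = - x$3" using d c y by auto
        ultimately show ?thesis using y by auto
      qed
      then show False using xy(1) by (simp add: vec3_simps)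
    qed
  qed (auto simp: two_fiber_form_def vec3_simps algebra_simps intro!: derivative_eq_intros)
qed

text \<open>The values at the coordinate lines leave \<open>[0 : 2 : 1]\<close> as the only further candidate.\<close>

lemma twistor_fibers_two_fiber_form:
  "finite (twistor_fibers_in (surface two_fiber_form)) \<and> card (twistor_fibers_in (surface two_fiber_form)) = 2"
proof -
  let ?U = "{axis 1 1, axis 2 1} :: (complex^3) set"
  have "finite (twistor_fibers_in (surface two_fiber_form)) \<and>
    card (twistor_fibers_in (surface two_fiber_form)) = card ?U"
  proof (rule card_twistor_fibers[OF bihom_two_fiber_form])
    fix a b c :: complex
    assume abc: "a \<noteq> 0 \<or> b \<noteq> 0 \<or> c \<noteq> 0"
      and "\<And>r s t. a * r + b * s + c * t = 0 \<Longrightarrow> two_fiber_form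
        (vector [s * cnj c - t * cnj b, t * cnj a - r * cnj c, r * cnj b - s * cnj a]) (vector [r, s, t]) = 0"
    then have t: "(s * cnj c - t * cnj b) * (s * t + 2 * (s * s)) + (t * cnj a - r * cnj c) * (r * t)
      + (r * cnj b - s * cnj a) * (r * s) = 0"
      if "a * r + b * s + c * t = 0" for r s t
      using that by (simp add: two_fiber_form_def algebra_simps)
    have 1: "(b * cnj b + c * cnj c) * c * (2 * c - b) = 0" using t[OF points_on_line(1)] by algebra
    have 2: "(a * cnj a + c * cnj c) * (a * c) = 0" using t[OF points_on_line(2)] by algebra
    have 3: "2 * a * cnj c * (a * a) + (a * cnj a + b * cnj b) * (a * b) = 0" using t[OF points_on_line(3)] by algebra
    have "c = 0"
    proof (rule ccontr)
      assume c: "c \<noteq> 0"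
      have "a = 0" using conj_norm_eq_0_iff[of a c] 2 c by auto
      moreover have "b = 2 * c" using conj_norm_eq_0_iff[of b c] 1 c by auto
      ultimately have "4 * cnj c = 0" using t[of 1 1 "-2"] by simp
      then show False using c by simp
    qed
    moreover from this have "a = 0 \<or> b = 0" using 3 conj_norm_eq_0_iff[of a b] by auto
    ultimately have "(vector [a, b, c] :: complex^3) = a *s axis 1 1
      \<or> (vector [a, b, c] :: complex^3) = b *s axis 2 1"
      by (auto simp: vec3_simps)
    then show "\<exists>v\<in>?U. \<exists>k. vector [a, b, c] = k *s v" by blast
  next
    fix v y :: "complex^3" assume "v \<in> ?U" "pairing v y = 0"
    then show "two_fiber_form (ccross y (conj_vec v)) y = 0" by (auto simp: two_fiber_form_def vec3_simps)
  qed (auto simp: vec3_simps)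
  moreover have "card ?U = 2" by (simp add: vec3_simps)
  ultimately show ?thesis by simp
qed

section \<open>A smooth surface with three twistor fibers\<close>

text \<open>The corresponding quadratic map \<open>Q y = (y\<^sub>2 y\<^sub>3, y\<^sub>1 y\<^sub>3, y\<^sub>1 y\<^sub>2)\<close> is the standard Cremona involution.\<close>

definition cremona_form :: "complex^3 \<Rightarrow> complex^3 \<Rightarrow> complex"
  where "cremona_form x y = x$1 * (y$2 * y$3) + x$2 * (y$1 * y$3) + x$3 * (y$1 * y$2)"

lemma bihom_cremona_form: "cremona_form \<in> bihom 1 2"
  unfolding cremona_form_def by (intro bihom_add bihom_cmult bihom_1_2_monomial)

lemma linear_system_cremona_form: "cremona_form \<in> linear_system 1 2"
  by (rule linear_systemI[OF bihom_cremona_form, of "vector [1, 0, 0]" "vector [0, 1, 1]"])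
    (simp_all add: cremona_form_def vec3_simps)

text \<open>For \<open>c \<noteq> 0\<close> the fixed points satisfy \<open>y\<^sub>i\<^sup>2 = c\<^sup>2\<close>. Then \<open>y\<^sub>1 (x \<cdot> y) = 0\<close> becomes
  \<open>c\<^sup>2 x\<^sub>1 + c (x\<^sub>2 y\<^sub>3 + x\<^sub>3 y\<^sub>2) = 2 c\<^sup>2 x\<^sub>1 = 0\<close>, and likewise for the other coordinates of \<open>x\<close>.\<close>

lemma smooth_cremona_form: "smooth_surface cremona_form"
proof -
  let ?Q = "\<lambda>y. vector [y$2 * y$3, y$1 * y$3, y$1 * y$2] :: complex^3"
  let ?Q' = "\<lambda>j y. vector [y$2 * axis j 1 $ 3 + axis j 1 $ 2 * y$3, y$1 * axis j 1 $ 3 + axis j 1 $ 1 * y$3,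
      y$1 * axis j 1 $ 2 + axis j 1 $ 1 * y$2] :: complex^3"
  show ?thesis
  proof (rule smooth_surfaceI[where Q = ?Q and Q' = ?Q'])
    fix x y :: "complex^3" and c
    assume xy: "x \<noteq> 0" "y \<noteq> 0" "pairing x y = 0"
      and e: "?Q y = c *s y" and d: "\<And>j. pairing x (?Q' j y) = c * x $ j"
    have e: "y$2 * y$3 = c * y$1" "y$1 * y$3 = c * y$2" "y$1 * y$2 = c * y$3"
      using e by (auto simp: vec3_simps)
    have d: "x$2 * y$3 + x$3 * y$2 = c * x$1" "x$1 * y$3 + x$3 * y$1 = c * x$2" "x$1 * y$2 + x$2 * y$1 = c * x$3"
      using d[of 1] d[of 2] d[of 3] by (simp_all add: vec3_simps)
    have p: "x$1 * y$1 + x$2 * y$2 + x$3 * y$3 = 0" using xy by (simp add: vec3_simps)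
    show False
    proof (cases "c = 0")
      case True
      then show False using e d p xy by (auto simp: vec3_simps)
    next
      case False
      then have "y$1 \<noteq> 0" "y$2 \<noteq> 0" "y$3 \<noteq> 0" using e xy(2) by (auto simp: vec3_simps)
      have "y$1 * (y$2 * y$2) = y$1 * (c * c)" "y$2 * (y$3 * y$3) = y$2 * (c * c)" "y$3 * (y$1 * y$1) = y$3 * (c * c)"
        using e by algebra+
      then have s: "y$1 * y$1 = c * c" "y$2 * y$2 = c * c" "y$3 * y$3 = c * c"
        using \<open>y$1 \<noteq> 0\<close> \<open>y$2 \<noteq> 0\<close> \<open>y$3 \<noteq> 0\<close> by auto
      have "2 * (c * c * x$1) = 0" using e d p s by algebra
      moreover have "2 * (c * c * x$2) = 0" using e d p s by algebra
      moreover have "2 * (c * c * x$3) = 0" using e d p s by algebra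
      ultimately show False using False xy by (simp add: vec3_simps)
    qed
  qed (auto simp: cremona_form_def vec3_simps algebra_simps intro!: derivative_eq_intros)
qed

lemma twistor_fibers_cremona_form:
  "finite (twistor_fibers_in (surface cremona_form)) \<and> card (twistor_fibers_in (surface cremona_form)) = 3"
proof -
  let ?U = "{axis 1 1, axis 2 1, axis 3 1} :: (complex^3) set"
  have "finite (twistor_fibers_in (surface cremona_form)) \<and>
    card (twistor_fibers_in (surface cremona_form)) = card ?U"
  proof (rule card_twistor_fibers[OF bihom_cremona_form])
    fix a b c :: complex
    assume abc: "a \<noteq> 0 \<or> b \<noteq> 0 \<or> c \<noteq> 0"
      and "\<And>r s t. a * r + b * s + c * t = 0 \<Longrightarrow> cremona_form
        (vector [s * cnj c - t * cnj b, t * cnj a - r * cnj c, r * cnj b - s * cnj a]) (vector [r, s, t]) = 0"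
    then have t: "(s * cnj c - t * cnj b) * (s * t) + (t * cnj a - r * cnj c) * (r * t) + (r * cnj b - s * cnj a) * (r * s) = 0"
      if "a * r + b * s + c * t = 0" for r s t
      using that by (simp add: cremona_form_def algebra_simps)
    have "(b * cnj b + c * cnj c) * (b * c) = 0" using t[OF points_on_line(1)] by algebra
    moreover have "(a * cnj a + c * cnj c) * (a * c) = 0" using t[OF points_on_line(2)] by algebra
    moreover have "(a * cnj a + b * cnj b) * (a * b) = 0" using t[OF points_on_line(3)] by algebra
    ultimately have "b * c = 0" "a * c = 0" "a * b = 0"
      using conj_norm_eq_0_iff[of b c] conj_norm_eq_0_iff[of a c] conj_norm_eq_0_iff[of a b] by auto
    then have "(vector [a, b, c] :: complex^3) = a *s axis 1 1
      \<or> (vector [a, b, c] :: complex^3) = b *s axis 2 1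
      \<or> (vector [a, b, c] :: complex^3) = c *s axis 3 1"
      by (auto simp: vec3_simps)
    then show "\<exists>v\<in>?U. \<exists>k. vector [a, b, c] = k *s v" by blast
  next
    fix v y :: "complex^3" assume "v \<in> ?U" "pairing v y = 0"
    then show "cremona_form (ccross y (conj_vec v)) y = 0" by (auto simp: cremona_form_def vec3_simps)
  qed (auto simp: vec3_simps)
  moreover have "card ?U = 3" by (simp add: vec3_simps)
  ultimately show ?thesis by simp
qed

section \<open>An irreducible surface with four twistor fibers\<close>

text \<open>The corresponding quadratic map \<open>Q y = (2 y\<^sub>2\<^sup>2, y\<^sub>1\<^sup>2 + y\<^sub>2\<^sup>2, 0)\<close> and its derivative vanish at
  \<open>[0 : 0 : 1]\<close>, so the surface is singular along the whole curve over that point.\<close>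

definition four_fiber_form :: "complex^3 \<Rightarrow> complex^3 \<Rightarrow> complex"
  where "four_fiber_form x y = 2 * (x$1 * (y$2 * y$2)) + x$2 * (y$1 * y$1) + x$2 * (y$2 * y$2)"

lemma bihom_four_fiber_form: "four_fiber_form \<in> bihom 1 2"
  unfolding four_fiber_form_def by (intro bihom_add bihom_cmult bihom_1_2_monomial)

lemma linear_system_four_fiber_form: "four_fiber_form \<in> linear_system 1 2"
  by (rule linear_systemI[OF bihom_four_fiber_form, of "vector [1, 0, 0]" "vector [0, 1, 0]"])
    (simp_all add: four_fiber_form_def vec3_simps)

text \<open>For real \<open>w\<close> this is \<open>(w - 1)\<^sup>2 = 0\<close>; otherwise the imaginary part forces \<open>Re w = -1\<close>. The
  double root is the purpose of the constant \<open>1\<close>: a slightly smaller constant would split it into two real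
  roots and give four solutions.\<close>

lemma antiholomorphic_quadratic:
  assumes "w * w + 1 = 2 * cnj w"
  shows "w = 1 \<or> w = - 1 + 2 * \<i> \<or> w = - 1 - 2 * \<i>"
proof -
  have re: "Re w * Re w - Im w * Im w + 1 = 2 * Re w" and im: "Im w * (Re w + 1) = 0"
    using assms by (auto simp: complex_eq_iff algebra_simps)
  show ?thesis
  proof (cases "Im w = 0")
    case True
    then have "(Re w - 1) * (Re w - 1) = 0" using re by (simp add: algebra_simps)
    then show ?thesis using True by (simp add: complex_eq_iff)
  next
    case False
    then have "Re w = - 1" using im by auto
    moreover have "(Im w - 2) * (Im w + 2) = 0" using re calculation by (simp add: algebra_simps)
    ultimately show ?thesis by (auto simp: complex_eq_iff)
  qed
qed

text \<open>The centers are forced onto the line \<open>c = 0\<close>. For \<open>[1 : w : 0]\<close> the restricted cubic is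
  \<open>w\<^sup>2 + 1 - 2 cnj w\<close> times a fixed nonzero cubic, and for \<open>[0 : 1 : 0]\<close> it is zero.\<close>

lemma twistor_fibers_four_fiber_form:
  "finite (twistor_fibers_in (surface four_fiber_form)) \<and> card (twistor_fibers_in (surface four_fiber_form)) = 4"
proof -
  let ?U = "{vector [0, 1, 0], vector [1, 1, 0],
    vector [1, - 1 + 2 * \<i>, 0], vector [1, - 1 - 2 * \<i>, 0]} :: (complex^3) set"
  have "finite (twistor_fibers_in (surface four_fiber_form)) \<and>
    card (twistor_fibers_in (surface four_fiber_form)) = card ?U"
  proof (rule card_twistor_fibers[OF bihom_four_fiber_form])
    fix a b c :: complex
    assume abc: "a \<noteq> 0 \<or> b \<noteq> 0 \<or> c \<noteq> 0"
      and "\<And>r s t. a * r + b * s + c * t = 0 \<Longrightarrow> four_fiber_form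
        (vector [s * cnj c - t * cnj b, t * cnj a - r * cnj c, r * cnj b - s * cnj a]) (vector [r, s, t]) = 0"
    then have t: "2 * (s * cnj c - t * cnj b) * (s * s) + (t * cnj a - r * cnj c) * (r * r + s * s) = 0"
      if "a * r + b * s + c * t = 0" for r s t
      using that by (simp add: four_fiber_form_def algebra_simps)
    have "(a * cnj a + c * cnj c) * (c * c) = 0" using t[OF points_on_line(2)] by algebra
    then have c: "c = 0" using conj_norm_eq_0_iff[of a c] by auto
    have e: "cnj a * (a * a + b * b) = 2 * cnj b * (a * a)" using t[of b "-a" 1] c by (simp add: add.commute)
    show "\<exists>v\<in>?U. \<exists>k. vector [a, b, c] = k *s v"
    proof (cases "a = 0")
      case True
      then show ?thesis using c by (auto simp: vec3_simps)
    next
      case False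
      define w where "w = b / a"
      have b: "b = a * w" using False by (simp add: w_def)
      have "cnj a * (a * a) * (w * w + 1) = cnj a * (a * a) * (2 * cnj w)"
        using e unfolding b by (simp add: algebra_simps)
      then have "w * w + 1 = 2 * cnj w" using False by simp
      then have "w = 1 \<or> w = - 1 + 2 * \<i> \<or> w = - 1 - 2 * \<i>" by (rule antiholomorphic_quadratic)
      moreover have "(vector [a, b, c] :: complex^3) = a *s vector [1, w, 0]" using b c by (simp add: vec3_simps)
      ultimately show ?thesis by blast
    qed
  next
    fix v y :: "complex^3" assume "v \<in> ?U" "pairing v y = 0"
    then have "v $ 3 = 0" and "v $ 1 = 0 \<or> v $ 1 = 1 \<and> v $ 2 * v $ 2 + 1 = 2 * cnj (v $ 2)"
      and "v $ 1 * y $ 1 + v $ 2 * y $ 2 = 0" and "v $ 1 = 0 \<Longrightarrow> v $ 2 = 1"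
      by (auto simp: pairing_3 algebra_simps)
    then show "four_fiber_form (ccross y (conj_vec v)) y = 0"
    proof (elim disjE conjE)
      assume *: "v $ 3 = 0" "v $ 1 = 1" "v $ 2 * v $ 2 + 1 = 2 * cnj (v $ 2)" "v $ 1 * y $ 1 + v $ 2 * y $ 2 = 0"
      have "- 2 * y $ 3 * cnj (v $ 2) * (y $ 2 * y $ 2) + y $ 3 * (y $ 1 * y $ 1 + y $ 2 * y $ 2) = 0"
        using *(2,3,4) by algebra
      then show ?thesis using * by (simp add: four_fiber_form_def algebra_simps)
    qed (auto simp: four_fiber_form_def)
  qed (auto simp: vec3_simps)
  moreover have "card ?U = 4" by (simp add: vec3_simps complex_eq_iff)
  ultimately show ?thesis by simp
qed

lemma irreducible_four_fiber_form: "zariski_irreducible (surface four_fiber_form)"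
proof -
  define \<phi> where "\<phi> = (\<lambda>y. ccross y (vector [2 * (y$2 * y$2), y$1 * y$1 + y$2 * y$2, 0]))"
  have ff: "four_fiber_form x y = pairing x (vector [2 * (y$2 * y$2), y$1 * y$1 + y$2 * y$2, 0])" for x y
    by (simp add: four_fiber_form_def pairing_3 algebra_simps)
  have \<phi>: "\<phi> y $ 1 = - (y$3 * (y$1 * y$1 + y$2 * y$2))" "\<phi> y $ 2 = y$3 * (2 * (y$2 * y$2))"
    "\<phi> y $ 3 = y$1 * (y$1 * y$1 + y$2 * y$2) - y$2 * (2 * (y$2 * y$2))" for y
    by (simp_all add: \<phi>_def)
  show ?thesis
  proof (rule irreducible_if_parametrized)
    show "poly_fun (\<lambda>t. \<phi> (p + t *s v) $ i)" for p v i
      using exhaust_3[of i] by (auto simp: \<phi>)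
    show "\<phi> 0 = 0" by (simp add: vec3_eq_iff \<phi>)
    show "\<phi> (vector [1, 0, 0]) \<noteq> 0" by (simp add: vec3_eq_iff \<phi>)
    show "(abs_p2 (\<phi> y), abs_p2 y) \<in> surface four_fiber_form" if "\<phi> y \<noteq> 0" for y
    proof -
      have "y \<noteq> 0" using that by (auto simp: vec3_eq_iff \<phi>)
      then show ?thesis
        using that surface_abs_iff[OF bihom_four_fiber_form] by (simp add: ff) (simp add: \<phi>_def pairing_ccross)
    qed
    fix g a b z assume g: "g \<in> bihom a b" "\<And>y. g (\<phi> y) y = 0" and z: "z \<in> surface four_fiber_form"
    obtain x y where xy: "x \<noteq> 0" "y \<noteq> 0" "z = (abs_p2 x, abs_p2 y)"
      by (metis p2_cases surj_pair)
    then have p: "pairing x y = 0" and fxy: "four_fiber_form x y = 0" using z surface_abs_iff[OF bihom_four_fiber_form] by auto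
    have scale: "g x y = 0" if "g x' y = 0" "x = c *s x'" for x' c
      using bihom_scale[OF g(1), of c x' 1 y] that by simp
    have "g x y = 0"
    proof (cases "\<phi> y = 0")
      case False
      then obtain c where "x = c *s \<phi> y"
        using orthogonal_imp_scale_ccross p fxy unfolding ff \<phi>_def by metis
      then show ?thesis using scale g(2) by blast
    next
      case True
      show ?thesis
      proof (cases "y$1 = 0 \<and> y$2 = 0")
        \<comment> \<open>Over \<open>[0 : 0 : 1]\<close> the limit of \<open>\<phi>\<close> depends on the direction \<open>(r, s)\<close> of approach. As
          \<open>(r, s)\<close> varies, the limit \<open>[-(r\<^sup>2 + s\<^sup>2) : 2 s\<^sup>2 : 0]\<close> takes all values with third coordinate \<open>0\<close>.\<close>
        case y: True
        then have y3: "y$3 \<noteq> 0" and x3: "x$3 = 0" using xy p by (auto simp: vec3_eq_iff pairing_3)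
        obtain r s where rs: "r \<noteq> 0 \<or> s \<noteq> 0" "x$2 * (r * r + s * s) = - 2 * x$1 * (s * s)"
        proof (cases "x$2 = 0")
          case True then show ?thesis using that[of 1 0] by simp
        next
          case False
          define r where "r = csqrt (- (2 * x$1 + x$2) / x$2)"
          have "r * r = - (2 * x$1 + x$2) / x$2" unfolding r_def by (metis power2_csqrt power2_eq_square)
          then have "x$2 * (r * r) = - (2 * x$1 + x$2)" using False by simp
          then have "x$2 * (r * r + 1 * 1) = - 2 * x$1 * (1 * 1)" by algebra
          then show ?thesis using that[of r 1] by simp
        qed
        let ?X = "\<lambda>t. vector [- (y$3 * (r * r + s * s)), y$3 * (2 * (s * s)), t * (r * (r * r + s * s) - 2 * (s * s * s))] :: complex^3"
        let ?Y = "\<lambda>t. vector [t * r, t * s, y$3] :: complex^3"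
        have Y0: "?Y 0 = y" using y by (simp add: vec3_eq_iff)
        have "g (?X 0) (?Y 0) = 0"
        proof (rule vanishing_along_arc[OF g])
          show "poly_fun (\<lambda>t. ?X t $ i)" "poly_fun (\<lambda>t. ?Y t $ i)" for i
            using exhaust_3[of i] by auto
          show "\<phi> (?Y t) = t ^ 2 *s ?X t" for t
            by (simp add: vec3_eq_iff \<phi> power2_eq_square algebra_simps)
        qed
        then have "g (?X 0) y = 0" using Y0 by simp
        moreover obtain c where "x = c *s ?X 0"
        proof (cases "s = 0")
          case True
          then have "x$2 = 0" "r \<noteq> 0" using rs by auto
          then have "x = (- x$1 / (y$3 * (r * r))) *s ?X 0"
            using True x3 y3 by (simp add: vec3_eq_iff)
          then show ?thesis by (rule that)
        next
          case False
          define k where "k = y$3 * (2 * (s * s))"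
          have k: "k \<noteq> 0" using False y3 by (simp add: k_def)
          have "x$1 * k = x$2 * - (y$3 * (r * r + s * s))" unfolding k_def using rs(2) by algebra
          then have "x = (x$2 / k) *s ?X 0"
            using x3 k unfolding k_def[symmetric] by (simp add: vec3_eq_iff field_simps)
          then show ?thesis by (rule that)
        qed
        ultimately show ?thesis by (rule scale)
      next
        case False
        \<comment> \<open>The other base points are the three simple zeros on \<open>y\<^sub>3 = 0\<close> of a binary cubic. The velocity
          \<open>(u, 0, w)\<close> of an arc through such a point determines the limit of \<open>\<phi>\<close>: \<open>w\<close> controls its first two
          coordinates, and \<open>u\<close> the third one.\<close>
        have y3: "y$3 = 0"
          using True False by (auto simp: vec3_eq_iff \<phi>)
        have c: "y$1 * (y$1 * y$1 + y$2 * y$2) = y$2 * (2 * (y$2 * y$2))"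
          using True by (simp add: vec3_eq_iff \<phi>)
        then have y2: "y$2 \<noteq> 0" using False by auto
        \<comment> \<open>The derivative of the cubic with respect to \<open>y\<^sub>1\<close>: its zeros on the line are simple.\<close>
        have d: "3 * (y$1 * y$1) + y$2 * y$2 \<noteq> 0"
        proof
          assume d: "3 * (y$1 * y$1) + y$2 * y$2 = 0"
          have "28 * (y$2 * y$2 * y$2 * y$2) = 0" using c d by algebra
          then show False using y2 by simp
        qed
        define w u where "w = x$2 / (2 * (y$2 * y$2))" and "u = x$3 / (3 * (y$1 * y$1) + y$2 * y$2)"
        let ?X = "\<lambda>t. vector [- (w * ((y$1 + t * u) * (y$1 + t * u) + y$2 * y$2)), w * (2 * (y$2 * y$2)),
           u * (3 * (y$1 * y$1) + y$2 * y$2) + t * (3 * y$1 * u * u + t * u * u * u)] :: complex^3"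
        let ?Y = "\<lambda>t. vector [y$1 + t * u, y$2, t * w] :: complex^3"
        have "g (?X 0) (?Y 0) = 0"
        proof (rule vanishing_along_arc[OF g])
          show "poly_fun (\<lambda>t. ?X t $ i)" "poly_fun (\<lambda>t. ?Y t $ i)" for i
            using exhaust_3[of i] by auto
          show "\<phi> (?Y t) = t ^ 1 *s ?X t" for t
            using c by (simp add: vec3_eq_iff \<phi> algebra_simps)
        qed
        moreover have "?Y 0 = y" using y3 by (simp add: vec3_eq_iff)
        moreover have "?X 0 = x"
          using y2 d fxy by (simp add: vec3_eq_iff four_fiber_form_def w_def u_def field_simps add_eq_0_iff)
        ultimately show ?thesis by simp
      qed
    qed
    then show "z \<in> zlocus g" using zlocus_abs_iff[OF g(1) xy(1,2)] xy(3) by simp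
  qed
qed

section \<open>Existence\<close>

theorem theorem1p3:
  shows "(\<forall>n::nat. 0 \<le> n \<and> n \<le> 3 \<longrightarrow>
      (\<exists>f \<in> linear_system 1 2. smooth_surface f \<and>
        finite (twistor_fibers_in (surface f)) \<and> card (twistor_fibers_in (surface f)) = n))
    \<and> (\<exists>f \<in> linear_system 1 2. zariski_irreducible (surface f) \<and>
        finite (twistor_fibers_in (surface f)) \<and> card (twistor_fibers_in (surface f)) = 4)"
proof (intro conjI allI impI)
  fix n :: nat assume "0 \<le> n \<and> n \<le> 3"
  then consider "n = 0" | "n = 1" | "n = 2" | "n = 3" by linarith
  then show "\<exists>f \<in> linear_system 1 2. smooth_surface f \<and>
      finite (twistor_fibers_in (surface f)) \<and> card (twistor_fibers_in (surface f)) = n"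
  proof cases
    case 1 then show ?thesis
      using linear_system_fermat_form smooth_fermat_form twistor_fibers_fermat_form by blast
  next
    case 2 then show ?thesis
      using linear_system_one_fiber_form smooth_one_fiber_form twistor_fibers_one_fiber_form by blast
  next
    case 3 then show ?thesis
      using linear_system_two_fiber_form smooth_two_fiber_form twistor_fibers_two_fiber_form by blast
  next
    case 4 then show ?thesis
      using linear_system_cremona_form smooth_cremona_form twistor_fibers_cremona_form by blast
  qed
next
  show "\<exists>f \<in> linear_system 1 2. zariski_irreducible (surface f) \<and>
      finite (twistor_fibers_in (surface f)) \<and> card (twistor_fibers_in (surface f)) = 4"
    using linear_system_four_fiber_form irreducible_four_fiber_form twistor_fibers_four_fiber_form by blast
qed

end
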